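(* Let $p$ be a prime and $n\ge1$. Every compatible measure-preserving function $F\colon\mathbb Z_p^n\to\mathbb Z_p^n$ is an isometry, i.e. $\|F(x)-F(y)\|_p=\|x-y\|_p$ for all $x,y\in\mathbb Z_p^n$.
   Context: $\mathbb Z_p^n$ carries the maximum norm $\|\cdot\|_p$ of the $p$-adic absolute values of components. $F$ is compatible if $\|F(x)-F(y)\|_p\le\|x-y\|_p$ for all $x,y$. $F$ is measure-preserving if $\mu_p(F^{-1}(M))=\mu_p(M)$ for every measurable $M\subset\mathbb Z_p^n$, where $\mu_p$ is the normalized Haar measure. *)

theory Defs
  imports "HOL-Probability.Probability" "HOL-Algebra.Ring" "HOL-Computational_Algebra.Primes"
begin

section \<open>The ring of p-adic integers\<close>

text \<open>
  The inverse limit of the rings of integers modulo \<open>p^k\<close>: an element is the coherent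
  sequence of its residues, \<open>x k\<close> being the representative of \<open>x\<close> modulo \<open>p^k\<close>
  in \<open>{0..<p^k}\<close>.
\<close>

definition padic_ints :: "nat \<Rightarrow> (nat \<Rightarrow> int) set" where
  "padic_ints p = {x. \<forall>k. x k \<in> {0..<int p ^ k} \<and> x (Suc k) mod int p ^ k = x k}"

definition padic_ring :: "nat \<Rightarrow> (nat \<Rightarrow> int) ring" where
  "padic_ring p =
     \<lparr>carrier = padic_ints p,
      mult = (\<lambda>x y k. (x k * y k) mod int p ^ k),
      one = (\<lambda>k. 1 mod int p ^ k),
      ring.zero = (\<lambda>k. 0),
      add = (\<lambda>x y k. (x k + y k) mod int p ^ k)\<rparr>"

text \<open>
  \<open>x k = 0\<close> says that \<open>p^k\<close> divides \<open>x\<close> (see \<open>padic_divides_iff\<close> below), so the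
  maximum is the exponent of \<open>p\<close> in \<open>x\<close>.
\<close>

definition padic_val :: "(nat \<Rightarrow> int) \<Rightarrow> nat" where
  "padic_val x = Max {k. x k = 0}"

definition padic_abs :: "nat \<Rightarrow> (nat \<Rightarrow> int) \<Rightarrow> real" where
  "padic_abs p x = (if x = \<zero>\<^bsub>padic_ring p\<^esub> then 0 else 1 / real p ^ padic_val x)"

section \<open>Vectors of p-adic integers and the maximum norm\<close>

definition padic_vecs :: "nat \<Rightarrow> nat \<Rightarrow> (nat \<Rightarrow> nat \<Rightarrow> int) set" where
  "padic_vecs p n = {..<n} \<rightarrow>\<^sub>E carrier (padic_ring p)"

definition vec_add :: "nat \<Rightarrow> nat \<Rightarrow> (nat \<Rightarrow> nat \<Rightarrow> int) \<Rightarrow> (nat \<Rightarrow> nat \<Rightarrow> int) \<Rightarrow> (nat \<Rightarrow> nat \<Rightarrow> int)" where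
  "vec_add p n x y = (\<lambda>i\<in>{..<n}. x i \<oplus>\<^bsub>padic_ring p\<^esub> y i)"

definition vec_diff :: "nat \<Rightarrow> nat \<Rightarrow> (nat \<Rightarrow> nat \<Rightarrow> int) \<Rightarrow> (nat \<Rightarrow> nat \<Rightarrow> int) \<Rightarrow> (nat \<Rightarrow> nat \<Rightarrow> int)" where
  "vec_diff p n x y = (\<lambda>i\<in>{..<n}. x i \<ominus>\<^bsub>padic_ring p\<^esub> y i)"

definition padic_norm :: "nat \<Rightarrow> nat \<Rightarrow> (nat \<Rightarrow> nat \<Rightarrow> int) \<Rightarrow> real" where
  "padic_norm p n x = Max ((\<lambda>i. padic_abs p (x i)) ` {..<n})"

definition compatible :: "nat \<Rightarrow> nat \<Rightarrow> ((nat \<Rightarrow> nat \<Rightarrow> int) \<Rightarrow> (nat \<Rightarrow> nat \<Rightarrow> int)) \<Rightarrow> bool" where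
  "compatible p n F \<longleftrightarrow>
     (\<forall>x\<in>padic_vecs p n. \<forall>y\<in>padic_vecs p n.
        padic_norm p n (vec_diff p n (F x) (F y)) \<le> padic_norm p n (vec_diff p n x y))"

section \<open>Normalized Haar measure and measure preservation\<close>

text \<open>
  The locale \<open>Metric_space\<close> demands symmetry also outside the carrier, hence the default value.
\<close>

definition padic_dist :: "nat \<Rightarrow> nat \<Rightarrow> (nat \<Rightarrow> nat \<Rightarrow> int) \<Rightarrow> (nat \<Rightarrow> nat \<Rightarrow> int) \<Rightarrow> real" where
  "padic_dist p n x y =
     (if x \<in> padic_vecs p n \<and> y \<in> padic_vecs p n then padic_norm p n (vec_diff p n x y) else 0)"

definition padic_topology :: "nat \<Rightarrow> nat \<Rightarrow> (nat \<Rightarrow> nat \<Rightarrow> int) topology" where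
  "padic_topology p n =
     Metric_space.mtopology (padic_vecs p n) (padic_dist p n)"

definition padic_borel :: "nat \<Rightarrow> nat \<Rightarrow> (nat \<Rightarrow> nat \<Rightarrow> int) measure" where
  "padic_borel p n = sigma (padic_vecs p n) {U. openin (padic_topology p n) U}"

text \<open>
  Regularity is not listed among the defining properties, because every finite Borel measure
  on a compact metric space is regular. Existence and uniqueness are proved below
  (\<open>normalized_haar_ex1\<close>).
\<close>

definition normalized_haar :: "nat \<Rightarrow> nat \<Rightarrow> (nat \<Rightarrow> nat \<Rightarrow> int) measure \<Rightarrow> bool" where
  "normalized_haar p n \<mu> \<longleftrightarrow>
     sets \<mu> = sets (padic_borel p n) \<and>
     emeasure \<mu> (padic_vecs p n) = 1 \<and>
     (\<forall>a\<in>padic_vecs p n. \<forall>A\<in>sets \<mu>. emeasure \<mu> (vec_add p n a ` A) = emeasure \<mu> A)"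

definition padic_haar :: "nat \<Rightarrow> nat \<Rightarrow> (nat \<Rightarrow> nat \<Rightarrow> int) measure" where
  "padic_haar p n = (THE \<mu>. normalized_haar p n \<mu>)"

text \<open>
  Measurability of the preimages is part of the definition, since \<open>emeasure\<close> is \<open>0\<close> on
  non-measurable sets.
\<close>

definition haar_preserving :: "nat \<Rightarrow> nat \<Rightarrow> ((nat \<Rightarrow> nat \<Rightarrow> int) \<Rightarrow> (nat \<Rightarrow> nat \<Rightarrow> int)) \<Rightarrow> bool" where
  "haar_preserving p n F \<longleftrightarrow>
     F \<in> measurable (padic_haar p n) (padic_haar p n) \<and>
     (\<forall>M\<in>sets (padic_haar p n).
        emeasure (padic_haar p n) (F -` M \<inter> padic_vecs p n) = emeasure (padic_haar p n) M)"

section \<open>Basic facts about p-adic integers\<close>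

lemma padic_intsI:
  assumes "\<And>k. 0 \<le> x k" "\<And>k. x k < int p ^ k" "\<And>k. x (Suc k) mod int p ^ k = x k"
  shows "x \<in> padic_ints p"
  using assms by (simp add: padic_ints_def)

lemma padic_intsD:
  assumes "x \<in> padic_ints p"
  shows "0 \<le> x k" "x k < int p ^ k" "x (Suc k) mod int p ^ k = x k" "x k mod int p ^ k = x k"
  using assms by (simp_all add: padic_ints_def)

lemma padic_mod_coherent:
  assumes "x \<in> padic_ints p" "j \<le> k"
  shows "x k mod int p ^ j = x j"
  using assms(2)
proof (induction k rule: dec_induct)
  case base
  show ?case using padic_intsD[OF assms(1)] by simp
next
  case (step k)
  have "x (Suc k) mod int p ^ j = (x (Suc k) mod int p ^ k) mod int p ^ j"
    using step by (simp add: mod_mod_cancel le_imp_power_dvd)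
  then show ?case using step padic_intsD[OF assms(1)] by simp
qed

lemma padic_ints_modI:
  assumes "p > 0" "\<And>k. f (Suc k) mod int p ^ k = f k mod int p ^ k"
  shows "(\<lambda>k. f k mod int p ^ k) \<in> padic_ints p"
proof (rule padic_intsI)
  fix k
  show "f (Suc k) mod int p ^ Suc k mod int p ^ k = f k mod int p ^ k"
    using assms(2)[of k] by (simp add: mod_mod_cancel le_imp_power_dvd del: power_Suc)
qed (use assms in auto)

lemma padic_ring_simps [simp]:
  "carrier (padic_ring p) = padic_ints p"
  "x \<otimes>\<^bsub>padic_ring p\<^esub> y = (\<lambda>k. (x k * y k) mod int p ^ k)"
  "\<one>\<^bsub>padic_ring p\<^esub> = (\<lambda>k. 1 mod int p ^ k)"
  "\<zero>\<^bsub>padic_ring p\<^esub> = (\<lambda>k. 0)"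
  "x \<oplus>\<^bsub>padic_ring p\<^esub> y = (\<lambda>k. (x k + y k) mod int p ^ k)"
  by (simp_all add: padic_ring_def)

lemma padic_add_closed:
  assumes "p > 0" "x \<in> padic_ints p" "y \<in> padic_ints p"
  shows "(\<lambda>k. (x k + y k) mod int p ^ k) \<in> padic_ints p"
  by (rule padic_ints_modI[OF assms(1)])
    (metis mod_add_eq padic_intsD(3) padic_intsD(4) assms(2,3))

lemma padic_diff_closed:
  assumes "p > 0" "x \<in> padic_ints p" "y \<in> padic_ints p"
  shows "(\<lambda>k. (x k - y k) mod int p ^ k) \<in> padic_ints p"
  by (rule padic_ints_modI[OF assms(1)])
    (metis mod_diff_eq padic_intsD(3) padic_intsD(4) assms(2,3))

lemma padic_mult_closed:
  assumes "p > 0" "x \<in> padic_ints p" "y \<in> padic_ints p"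
  shows "(\<lambda>k. (x k * y k) mod int p ^ k) \<in> padic_ints p"
  by (rule padic_ints_modI[OF assms(1)])
    (metis mod_mult_eq padic_intsD(3) padic_intsD(4) assms(2,3))

lemma padic_const_closed:
  "p > 0 \<Longrightarrow> (\<lambda>k. c mod int p ^ k) \<in> padic_ints p"
  using padic_ints_modI[of p "\<lambda>k. c"] by simp

lemma padic_zero_closed: "p > 0 \<Longrightarrow> (\<lambda>k. 0) \<in> padic_ints p"
  using padic_const_closed[of p 0] by simp

lemma padic_cring:
  assumes "p > 0"
  shows "cring (padic_ring p)"
proof (rule cringI)
  show "abelian_group (padic_ring p)"
  proof (rule abelian_groupI)
    fix x assume x: "x \<in> carrier (padic_ring p)"
    have "(\<lambda>k. (0 - x k) mod int p ^ k) \<in> padic_ints p"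
      using padic_diff_closed[OF assms padic_zero_closed[OF assms], of x] x by simp
    moreover have "((0 - x k) mod int p ^ k + x k) mod int p ^ k = 0" for k
      by (simp add: mod_simps)
    ultimately show "\<exists>y\<in>carrier (padic_ring p). y \<oplus>\<^bsub>padic_ring p\<^esub> x = \<zero>\<^bsub>padic_ring p\<^esub>"
      by (intro bexI[of _ "\<lambda>k. (0 - x k) mod int p ^ k"]) auto
  qed (use assms in \<open>auto simp: padic_add_closed padic_zero_closed padic_intsD(4) mod_simps
        add.assoc add.commute add.left_commute fun_eq_iff\<close>)
  show "comm_monoid (padic_ring p)"
    by (rule comm_monoidI)
      (use assms in \<open>auto simp: padic_mult_closed padic_const_closed padic_intsD(4) mod_simps
        mult.assoc mult.commute mult.left_commute fun_eq_iff\<close>)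
qed (auto simp: mod_simps fun_eq_iff distrib_right)

lemma padic_minus:
  assumes "p > 0" "x \<in> padic_ints p" "y \<in> padic_ints p"
  shows "x \<ominus>\<^bsub>padic_ring p\<^esub> y = (\<lambda>k. (x k - y k) mod int p ^ k)"
proof -
  interpret cring "padic_ring p" using padic_cring[OF assms(1)] .
  have c: "(\<lambda>k. (0 - y k) mod int p ^ k) \<in> padic_ints p"
    using padic_diff_closed[OF assms(1) padic_zero_closed assms(3)] assms(1) by simp
  have "\<ominus>\<^bsub>padic_ring p\<^esub> y = (\<lambda>k. (0 - y k) mod int p ^ k)"
    by (rule minus_equality) (use c assms in \<open>auto simp: mod_simps\<close>)
  then show ?thesis
    by (simp add: a_minus_def mod_simps fun_eq_iff)
qed

lemma padic_minus_eq_0_iff: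
  assumes "p > 0" "x \<in> padic_ints p" "y \<in> padic_ints p"
  shows "(x \<ominus>\<^bsub>padic_ring p\<^esub> y) k = 0 \<longleftrightarrow> x k = y k"
proof -
  have "(x \<ominus>\<^bsub>padic_ring p\<^esub> y) k = 0 \<longleftrightarrow> x k mod int p ^ k = y k mod int p ^ k"
    unfolding padic_minus[OF assms] mod_eq_dvd_iff by (rule mod_eq_0_iff_dvd)
  then show ?thesis
    unfolding padic_intsD(4)[OF assms(2)] padic_intsD(4)[OF assms(3)] .
qed

lemma padic_divides_iff:
  assumes "p > 0" "x \<in> padic_ints p"
  shows "(\<exists>y\<in>carrier (padic_ring p). x = (\<lambda>j. int p ^ k mod int p ^ j) \<otimes>\<^bsub>padic_ring p\<^esub> y) \<longleftrightarrow> x k = 0"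
proof
  assume "\<exists>y\<in>carrier (padic_ring p). x = (\<lambda>j. int p ^ k mod int p ^ j) \<otimes>\<^bsub>padic_ring p\<^esub> y"
  then obtain y where "x = (\<lambda>j. (int p ^ k mod int p ^ j * y j) mod int p ^ j)"
    by auto
  then show "x k = 0" by simp
next
  assume x0: "x k = 0"
  define y where "y = (\<lambda>j. x (j + k) div int p ^ k)"
  have xy: "x (j + k) = int p ^ k * y j" for j
  proof -
    have "x (j + k) mod int p ^ k = 0"
      using padic_mod_coherent[OF assms(2), of k "j + k"] x0 by simp
    then show ?thesis by (auto simp: y_def)
  qed
  have pk: "int p ^ k > 0" using assms by simp
  have y: "y \<in> padic_ints p"
  proof (rule padic_intsI)
    fix j
    show "0 \<le> y j"
      unfolding y_def using padic_intsD(1)[OF assms(2), of "j + k"] pk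
      by (simp add: pos_imp_zdiv_nonneg_iff)
    have "int p ^ k * y j < int p ^ k * int p ^ j"
      using padic_intsD(2)[OF assms(2), of "j + k"] xy[of j] by (simp add: power_add mult.commute)
    then show "y j < int p ^ j" using pk by simp
    have "int p ^ k * (y (Suc j) mod int p ^ j) = (int p ^ k * y (Suc j)) mod (int p ^ k * int p ^ j)"
      by (rule mult_mod_right)
    also have "\<dots> = x (Suc (j + k)) mod int p ^ (j + k)"
      using xy[of "Suc j"] by (simp only: power_add mult.commute add_Suc)
    also have "\<dots> = int p ^ k * y j"
      unfolding xy[symmetric] by (rule padic_intsD(3)[OF assms(2)])
    finally have "int p ^ k * (y (Suc j) mod int p ^ j) = int p ^ k * y j" .
    then show "y (Suc j) mod int p ^ j = y j" using pk by (metis less_irrefl mult_left_cancel)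
  qed
  have "x j = (int p ^ k mod int p ^ j * y j) mod int p ^ j" for j
    using padic_mod_coherent[OF assms(2), of j "j + k"] xy[of j] by (simp add: mod_simps)
  then have "x = (\<lambda>j. int p ^ k mod int p ^ j) \<otimes>\<^bsub>padic_ring p\<^esub> y"
    by (auto simp: fun_eq_iff)
  then show "\<exists>y\<in>carrier (padic_ring p). x = (\<lambda>j. int p ^ k mod int p ^ j) \<otimes>\<^bsub>padic_ring p\<^esub> y"
    using y by auto
qed

lemma padic_abs_le_iff:
  assumes "p \<ge> 2" "x \<in> padic_ints p"
  shows "padic_abs p x \<le> 1 / real p ^ k \<longleftrightarrow> x k = 0"
proof (cases "x = (\<lambda>k. 0)")
  case True
  then show ?thesis by (simp add: padic_abs_def)
next
  case False
  then obtain m where m: "x m \<noteq> 0" by auto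
  have mono: "x j = 0" if "x k = 0" "j \<le> k" for j k
    using padic_mod_coherent[OF assms(2) that(2)] that(1) by simp
  then have sub: "{k. x k = 0} \<subseteq> {..<m}"
    using m by (metis (mono_tags) lessThan_iff mem_Collect_eq not_le subsetI)
  then have fin: "finite {k. x k = 0}" using finite_subset by blast
  have x0: "x 0 = 0" using padic_intsD(1,2)[OF assms(2), of 0] by simp
  have "x k = 0 \<longleftrightarrow> k \<le> padic_val x"
  proof
    show "x k = 0 \<Longrightarrow> k \<le> padic_val x" unfolding padic_val_def using fin by simp
    have "padic_val x \<in> {k. x k = 0}"
      unfolding padic_val_def using fin x0 by (intro Max_in) auto
    then show "k \<le> padic_val x \<Longrightarrow> x k = 0" using mono by auto
  qed
  moreover have "1 / real p ^ v \<le> 1 / real p ^ k \<longleftrightarrow> k \<le> v" for v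
    using assms(1) by (simp add: field_simps)
  ultimately show ?thesis using False by (simp add: padic_abs_def)
qed

lemma padic_abs_cases: "padic_abs p x = 0 \<or> (\<exists>k. padic_abs p x = 1 / real p ^ k)"
  by (auto simp: padic_abs_def)

section \<open>The metric and its Borel sets\<close>

locale padic_space =
  fixes p n :: nat
  assumes p: "p \<ge> 2" and n: "n \<ge> 1"
begin

abbreviation "V \<equiv> padic_vecs p n"
abbreviation "d \<equiv> (\<lambda>x y. padic_norm p n (vec_diff p n x y))"

lemma p_pos: "p > 0" using p by simp

lemma V_D: "x \<in> V \<Longrightarrow> i < n \<Longrightarrow> x i \<in> padic_ints p"
  by (auto simp: padic_vecs_def)

lemma V_eqI: "x \<in> V \<Longrightarrow> y \<in> V \<Longrightarrow> (\<And>i k. i < n \<Longrightarrow> x i k = y i k) \<Longrightarrow> x = y"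
  unfolding padic_vecs_def by (rule PiE_ext) auto

lemma norm_cases: "padic_norm p n z = 0 \<or> (\<exists>k. padic_norm p n z = 1 / real p ^ k)"
proof -
  have "padic_norm p n z \<in> (\<lambda>i. padic_abs p (z i)) ` {..<n}"
    unfolding padic_norm_def using n by (intro Max_in) (auto simp: lessThan_empty_iff)
  then obtain i where "padic_norm p n z = padic_abs p (z i)" by blast
  then show ?thesis using padic_abs_cases[of p "z i"] by simp
qed

lemma dist_le_iff:
  assumes "x \<in> V" "y \<in> V"
  shows "d x y \<le> 1 / real p ^ k \<longleftrightarrow> (\<forall>i<n. x i k = y i k)"
proof -
  have "d x y \<le> 1 / real p ^ k \<longleftrightarrow> (\<forall>i<n. padic_abs p (vec_diff p n x y i) \<le> 1 / real p ^ k)"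
    unfolding padic_norm_def using n by (subst Max_le_iff) (auto simp: lessThan_empty_iff)
  also have "\<dots> \<longleftrightarrow> (\<forall>i<n. x i k = y i k)"
  proof (intro all_cong imp_cong refl)
    fix i assume i: "i < n"
    note xy = V_D[OF assms(1) i] V_D[OF assms(2) i]
    have "x i \<ominus>\<^bsub>padic_ring p\<^esub> y i \<in> padic_ints p"
      using padic_diff_closed[OF p_pos xy] padic_minus[OF p_pos xy] by simp
    then show "padic_abs p (vec_diff p n x y i) \<le> 1 / real p ^ k \<longleftrightarrow> x i k = y i k"
      using i padic_abs_le_iff[OF p] padic_minus_eq_0_iff[OF p_pos xy] by (simp add: vec_diff_def)
  qed
  finally show ?thesis .
qed

lemma dist_nonneg: "0 \<le> d x y"
  using norm_cases[of "vec_diff p n x y"] by auto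

lemma small_power: "e > 0 \<Longrightarrow> \<exists>k. 1 / real p ^ k < e"
  using real_arch_pow_inv[of e "1 / real p"] p by (auto simp: power_one_over)

lemma dist_eq_0_iff:
  assumes "x \<in> V" "y \<in> V"
  shows "d x y = 0 \<longleftrightarrow> x = y"
proof
  assume "d x y = 0"
  then have "d x y \<le> 1 / real p ^ k" for k by simp
  then show "x = y" using assms dist_le_iff V_eqI by blast
next
  assume "x = y"
  then have le: "d x y \<le> 1 / real p ^ k" for k using dist_le_iff assms by simp
  show "d x y = 0"
    using small_power[of "d x y"] dist_nonneg[of x y] le by (meson less_eq_real_def not_le)
qed

lemma dist_ultra:
  assumes "x \<in> V" "y \<in> V" "z \<in> V"
  shows "d x z \<le> max (d x y) (d y z)"
proof -
  consider "max (d x y) (d y z) = 0" | k where "max (d x y) (d y z) = 1 / real p ^ k"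
    using norm_cases by (metis max_def)
  then show ?thesis
  proof cases
    case 1
    then have "d x y = 0" "d y z = 0" using dist_nonneg[of x y] dist_nonneg[of y z] by linarith+
    then show ?thesis using assms dist_eq_0_iff by (metis max.idem order_refl)
  next
    case 2
    then have "d x y \<le> 1 / real p ^ k" "d y z \<le> 1 / real p ^ k" by linarith+
    then show ?thesis unfolding 2 using assms dist_le_iff by simp
  qed
qed

lemma dist_commute: 
  assumes "x \<in> V" "y \<in> V"
  shows "d x y = d y x"
proof -
  have "d x y \<le> d y x" if "x \<in> V" "y \<in> V" for x y
    using norm_cases[of "vec_diff p n y x"]
  proof
    assume "d y x = 0" then show ?thesis using that dist_eq_0_iff by (metis order_refl)
  next
    assume "\<exists>k. d y x = 1 / real p ^ k" 
    then obtain k where k: "d y x = 1 / real p ^ k" ..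
    then have "d y x \<le> 1 / real p ^ k" by simp
    then have "\<forall>i<n. y i k = x i k" using dist_le_iff that by blast
    then show ?thesis unfolding k using dist_le_iff that by simp
  qed
  then show ?thesis using assms by (meson order_antisym)
qed

sublocale M: Metric_space V "padic_dist p n"
proof
  fix x y z
  show "0 \<le> padic_dist p n x y"
    using dist_nonneg by (simp add: padic_dist_def)
  show "padic_dist p n x y = padic_dist p n y x"
    using dist_commute by (simp add: padic_dist_def)
  assume x: "x \<in> V" and y: "y \<in> V"
  then show "padic_dist p n x y = 0 \<longleftrightarrow> x = y"
    using dist_eq_0_iff by (simp add: padic_dist_def)
  assume z: "z \<in> V"
  show "padic_dist p n x z \<le> padic_dist p n x y + padic_dist p n y z"
    using dist_ultra[OF x y z] dist_nonneg[of x y] dist_nonneg[of y z] x y z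
    by (simp add: padic_dist_def)
qed

definition "cyl k a = {x \<in> V. \<forall>i<n. x i k = a i k}"

lemma cyl_subset: "cyl k a \<subseteq> V"
  by (auto simp: cyl_def)

lemma cyl_antimono: "a \<in> V \<Longrightarrow> b \<in> V \<Longrightarrow> j \<le> k \<Longrightarrow> \<forall>i<n. a i k = b i k \<Longrightarrow> \<forall>i<n. a i j = b i j"
  by (metis V_D padic_mod_coherent)

lemma openin_iff:
  "openin (padic_topology p n) U \<longleftrightarrow> U \<subseteq> V \<and> (\<forall>x\<in>U. \<exists>k. cyl k x \<subseteq> U)"
proof -
  have "(\<exists>r>0. M.mball x r \<subseteq> U) \<longleftrightarrow> (\<exists>k. cyl k x \<subseteq> U)" if x: "x \<in> V" for x
  proof
    assume "\<exists>r>0. M.mball x r \<subseteq> U"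
    then obtain r where r: "r > 0" "M.mball x r \<subseteq> U" by blast
    obtain k where k: "1 / real p ^ k < r" using small_power r by blast
    have "y \<in> M.mball x r" if "y \<in> cyl k x" for y
      using that x k dist_le_iff[of x y k] by (auto simp: cyl_def M.in_mball padic_dist_def)
    then show "\<exists>k. cyl k x \<subseteq> U" using r by blast
  next
    assume "\<exists>k. cyl k x \<subseteq> U"
    then obtain k where k: "cyl k x \<subseteq> U" ..
    have "y \<in> cyl k x" if "y \<in> M.mball x (1 / real p ^ k)" for y
      using that x dist_le_iff[of x y k] by (auto simp: cyl_def M.in_mball padic_dist_def)
    then show "\<exists>r>0. M.mball x r \<subseteq> U"
      using k p by (intro exI[of _ "1 / real p ^ k"]) auto
  qed
  then show ?thesis
    unfolding padic_topology_def M.openin_mtopology by blast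
qed

lemma openin_cyl: "a \<in> V \<Longrightarrow> openin (padic_topology p n) (cyl k a)"
  unfolding openin_iff using cyl_subset by (auto simp: cyl_def intro!: exI[of _ k])

definition "cyls k = cyl k ` V"

lemma finite_cyls: "finite (cyls k)"
proof -
  let ?R = "{..<n} \<rightarrow>\<^sub>E {0..<int p ^ k}"
  have "cyls k \<subseteq> (\<lambda>r. {x \<in> V. \<forall>i<n. x i k = r i}) ` ?R"
  proof
    fix C assume "C \<in> cyls k"
    then obtain a where a: "a \<in> V" "C = cyl k a" by (auto simp: cyls_def)
    then have "C = {x \<in> V. \<forall>i<n. x i k = (\<lambda>i\<in>{..<n}. a i k) i}" by (auto simp: cyl_def)
    moreover have "(\<lambda>i\<in>{..<n}. a i k) \<in> ?R" using padic_intsD(1,2)[OF V_D[OF a(1)]] by auto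
    ultimately show "C \<in> (\<lambda>r. {x \<in> V. \<forall>i<n. x i k = r i}) ` ?R" by (rule image_eqI)
  qed
  then show ?thesis by (rule finite_subset) (intro finite_imageI finite_PiE, auto)
qed

lemma cyl_self: "a \<in> V \<Longrightarrow> a \<in> cyl k a"
  by (simp add: cyl_def)

lemma Union_cyls: "\<Union> (cyls k) = V"
  using cyl_self cyl_subset unfolding cyls_def by blast

lemma disjoint_cyls: "disjoint (cyls k)"
  by (auto simp: cyls_def disjoint_def cyl_def)

definition "E = insert {} (\<Union>k. cyls k)"

lemma E_Pow: "E \<subseteq> Pow V"
  by (auto simp: E_def cyls_def cyl_def)

lemma cyl_int:
  assumes "a \<in> V" "b \<in> V" "j \<le> k" 
  shows "cyl j a \<inter> cyl k b = {} \<or> cyl j a \<inter> cyl k b = cyl k b"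
proof (cases "\<forall>i<n. b i j = a i j")
  case True
  then have "cyl k b \<subseteq> cyl j a"
    using cyl_antimono[OF _ assms(2,3)] by (fastforce simp: cyl_def)
  then show ?thesis by blast
next
  case False
  then have "cyl j a \<inter> cyl k b = {}"
    using cyl_antimono[OF _ assms(2,3)] by (fastforce simp: cyl_def)
  then show ?thesis ..
qed

lemma Int_stable_E: "Int_stable E"
proof (rule Int_stableI)
  fix A B assume "A \<in> E" "B \<in> E"
  then consider "A \<inter> B = {}" | a b j k where "A = cyl j a" "B = cyl k b" "a \<in> V" "b \<in> V"
    by (auto simp: E_def cyls_def)
  then show "A \<inter> B \<in> E"
  proof cases
    case 2
    have "A \<inter> B \<in> {{}, A, B}"
      using cyl_int[OF 2(3,4), of j k] cyl_int[OF 2(4,3), of k j] 2 nat_le_linear[of j k]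
      by (auto simp: Int_commute)
    then show ?thesis using \<open>A \<in> E\<close> \<open>B \<in> E\<close> by (auto simp: E_def)
  qed (simp add: E_def)
qed

lemma countable_E: "countable E"
  unfolding E_def using finite_cyls by (auto intro: countable_finite)

lemma space_borel: "space (padic_borel p n) = V"
  unfolding padic_borel_def by (rule space_measure_of) (auto simp: openin_iff)

lemma sets_borel: "sets (padic_borel p n) = sigma_sets V E"
proof -
  have "sets (padic_borel p n) = sigma_sets V {U. openin (padic_topology p n) U}"
    unfolding padic_borel_def by (rule sets_measure_of) (auto simp: openin_iff)
  also have "\<dots> = sigma_sets V E"
  proof (rule sigma_sets_eqI)
    fix U assume U: "U \<in> {U. openin (padic_topology p n) U}"
    have "U = \<Union> {C \<in> E. C \<subseteq> U}"
    proof
      show "U \<subseteq> \<Union> {C \<in> E. C \<subseteq> U}"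
      proof
        fix x assume x: "x \<in> U"
        with U obtain k where k: "x \<in> V" "cyl k x \<subseteq> U" unfolding openin_iff by blast
        then show "x \<in> \<Union> {C \<in> E. C \<subseteq> U}" using cyl_self by (auto simp: E_def cyls_def)
      qed
    qed auto
    moreover have "\<Union> {C \<in> E. C \<subseteq> U} \<in> sigma_sets V E"
      by (rule sigma_sets_UNION)
        (auto intro: countable_subset[OF _ countable_E])
    ultimately show "U \<in> sigma_sets V E" by simp
  next
    fix C assume "C \<in> E"
    then have "openin (padic_topology p n) C"
      using openin_cyl by (auto simp: E_def cyls_def)
    then show "C \<in> sigma_sets V {U. openin (padic_topology p n) U}" by auto
  qed
  finally show ?thesis .
qed

lemma cyl_sets: "a \<in> V \<Longrightarrow> cyl k a \<in> sets (padic_borel p n)"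
  unfolding sets_borel E_def cyls_def by (intro sigma_sets.Basic) auto

lemma V_eq_cyl: "a \<in> V \<Longrightarrow> cyl 0 a = V"
proof -
  assume a: "a \<in> V"
  have "x i 0 = 0" if "x \<in> V" "i < n" for x i
    using padic_intsD(1,2)[OF V_D[OF that], of 0] by simp
  then have "x i 0 = a i 0" if "x \<in> V" "i < n" for x i
    using that a by metis
  then show ?thesis unfolding cyl_def by blast
qed

definition "zerov = (\<lambda>i\<in>{..<n}. (\<lambda>k. 0 :: int))"

lemma zerov: "zerov \<in> V"
  using padic_zero_closed[OF p_pos] by (auto simp: zerov_def padic_vecs_def)

lemma measure_eqI_E:
  assumes "sets \<mu> = sets (padic_borel p n)" "sets \<nu> = sets (padic_borel p n)"
    and "emeasure \<mu> V \<noteq> \<infinity>"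
    and "\<And>k a. a \<in> V \<Longrightarrow> emeasure \<mu> (cyl k a) = emeasure \<nu> (cyl k a)"
  shows "\<mu> = \<nu>"
proof (rule measure_eqI_generator_eq[OF Int_stable_E E_Pow, where A = "\<lambda>_. V"])
  show "range (\<lambda>_. V) \<subseteq> E"
    using V_eq_cyl[OF zerov] zerov by (auto simp: E_def cyls_def)
qed (use assms in \<open>auto simp: sets_borel E_def cyls_def\<close>)

section \<open>Translations\<close>

lemma vec_add_closed: "a \<in> V \<Longrightarrow> b \<in> V \<Longrightarrow> vec_add p n a b \<in> V"
  using padic_add_closed[OF p_pos] by (auto simp: vec_add_def padic_vecs_def)

lemma vec_diff_closed: "a \<in> V \<Longrightarrow> b \<in> V \<Longrightarrow> vec_diff p n a b \<in> V"
  using padic_diff_closed[OF p_pos] padic_minus[OF p_pos]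
  by (auto simp: vec_diff_def padic_vecs_def PiE_def Pi_def)

lemma vec_add_nth: "i < n \<Longrightarrow> vec_add p n a b i k = (a i k + b i k) mod int p ^ k"
  by (simp add: vec_add_def)

lemma vec_diff_nth:
  "a \<in> V \<Longrightarrow> b \<in> V \<Longrightarrow> i < n \<Longrightarrow> vec_diff p n a b i k = (a i k - b i k) mod int p ^ k"
  by (simp add: vec_diff_def padic_minus[OF p_pos V_D V_D])

lemma V_nth_mod: "a \<in> V \<Longrightarrow> i < n \<Longrightarrow> a i k mod int p ^ k = a i k"
  using V_D padic_intsD(4) by blast

lemma add_diff: "a \<in> V \<Longrightarrow> b \<in> V \<Longrightarrow> vec_add p n a (vec_diff p n b a) = b"
  by (rule V_eqI)
    (simp_all add: vec_add_closed vec_diff_closed vec_add_nth vec_diff_nth mod_simps V_nth_mod)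

lemma diff_add: "a \<in> V \<Longrightarrow> b \<in> V \<Longrightarrow> vec_diff p n (vec_add p n a b) a = b"
  by (rule V_eqI)
    (simp_all add: vec_add_closed vec_diff_closed vec_add_nth vec_diff_nth mod_simps V_nth_mod)

lemma vec_add_image:
  assumes "a \<in> V" "A \<subseteq> V"
  shows "vec_add p n a ` A = (\<lambda>x. vec_diff p n x a) -` A \<inter> V"
proof
  show "vec_add p n a ` A \<subseteq> (\<lambda>x. vec_diff p n x a) -` A \<inter> V"
    using assms diff_add vec_add_closed by auto
  show "(\<lambda>x. vec_diff p n x a) -` A \<inter> V \<subseteq> vec_add p n a ` A"
  proof
    fix x assume "x \<in> (\<lambda>x. vec_diff p n x a) -` A \<inter> V"
    then show "x \<in> vec_add p n a ` A"
      using add_diff[OF assms(1), of x, symmetric] by (intro image_eqI[of x _ "vec_diff p n x a"]) auto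
  qed
qed

lemma vec_add_cyl:
  assumes "a \<in> V" "b \<in> V"
  shows "vec_add p n a ` cyl k b = cyl k (vec_add p n a b)"
proof -
  have "x \<in> V \<Longrightarrow> i < n \<Longrightarrow> vec_diff p n x a i k = b i k \<longleftrightarrow> x i k = vec_add p n a b i k" for x i
    using assms add_diff[of a x] diff_add[of a b] vec_diff_closed[of x a]
      vec_add_closed[of a b]
    by (metis vec_add_nth vec_diff_nth)
  then show ?thesis
    unfolding vec_add_image[OF assms(1) cyl_subset]
    using assms vec_diff_closed by (auto simp: cyl_def)
qed

lemma cyl_translate:
  assumes "a \<in> V"
  shows "vec_add p n a ` cyl k zerov = cyl k a"
proof -
  have "vec_add p n a zerov = a"
    by (rule V_eqI)
      (simp_all add: assms vec_add_closed zerov vec_add_nth V_nth_mod, simp add: zerov_def assms V_nth_mod)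
  then show ?thesis using vec_add_cyl[OF assms zerov] by simp
qed

lemma vec_diff_measurable:
  assumes "a \<in> V"
  shows "(\<lambda>x. vec_diff p n x a) \<in> measurable (padic_borel p n) (padic_borel p n)"
proof (rule measurable_sigma_sets[OF sets_borel E_Pow])
  show "(\<lambda>x. vec_diff p n x a) \<in> space (padic_borel p n) \<rightarrow> V"
    using assms vec_diff_closed by (simp add: space_borel)
  fix C assume "C \<in> E"
  then show "(\<lambda>x. vec_diff p n x a) -` C \<inter> space (padic_borel p n) \<in> sets (padic_borel p n)"
    unfolding E_def cyls_def space_borel
    using assms vec_add_image[OF assms cyl_subset] vec_add_cyl[OF assms] vec_add_closed[OF assms] cyl_sets
    by (auto simp: sets.empty_sets)
qed

lemma haar_cyl:
  assumes "normalized_haar p n \<mu>" "a \<in> V"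
  shows "of_nat (card (cyls k)) * emeasure \<mu> (cyl k a) = 1"
proof -
  have sets: "sets \<mu> = sets (padic_borel p n)" using assms(1) by (simp add: normalized_haar_def)
  have eq: "emeasure \<mu> (cyl k b) = emeasure \<mu> (cyl k zerov)" if "b \<in> V" for b
    using assms(1) cyl_translate[OF that, of k] cyl_sets[OF zerov, of k] that
    unfolding normalized_haar_def by metis
  have "1 = emeasure \<mu> (\<Union> (cyls k))"
    using assms(1) unfolding Union_cyls normalized_haar_def by simp
  also have "\<dots> = (\<Sum>C\<in>cyls k. emeasure \<mu> C)"
  proof -
    have "cyls k \<subseteq> sets \<mu>" using sets cyl_sets by (auto simp: cyls_def)
    moreover have "disjoint_family_on (\<lambda>C. C) (cyls k)"
      using disjoint_cyls by (auto simp: disjoint_family_on_def disjoint_def)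
    ultimately show ?thesis
      using sum_emeasure[of "\<lambda>C. C" "cyls k" \<mu>] finite_cyls by simp
  qed
  also have "\<dots> = (\<Sum>C\<in>cyls k. emeasure \<mu> (cyl k a))"
    using eq assms(2) by (intro sum.cong) (auto simp: cyls_def)
  finally show ?thesis by simp
qed

lemma haar_unique:
  assumes "normalized_haar p n \<mu>" "normalized_haar p n \<nu>"
  shows "\<mu> = \<nu>"
proof (rule measure_eqI_E)
  fix k a assume a: "a \<in> V"
  have c: "of_nat (card (cyls k)) \<noteq> (0 :: ennreal)" "of_nat (card (cyls k)) \<noteq> (\<top> :: ennreal)"
    using finite_cyls zerov by (auto simp: cyls_def of_nat_eq_0_iff)
  show "emeasure \<mu> (cyl k a) = emeasure \<nu> (cyl k a)"
    using haar_cyl[OF assms(1) a, of k] haar_cyl[OF assms(2) a, of k] c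
    by (metis ennreal_mult_cancel_left)
qed (use assms in \<open>auto simp: normalized_haar_def\<close>)

section \<open>Existence of the Haar measure\<close>

text \<open>The image of the product measure on digit expansions.\<close>

definition "digits = PiM ({..<n} \<times> UNIV) (\<lambda>_. uniform_count_measure {0..<int p})"

definition expand :: "(nat \<times> nat \<Rightarrow> int) \<Rightarrow> nat \<Rightarrow> nat \<Rightarrow> int" where
  "expand w = (\<lambda>i\<in>{..<n}. \<lambda>k. \<Sum>j<k. w (i, j) * int p ^ j)"

lemma digits_prob: "prob_space (uniform_count_measure {0..<int p})"
  using p_pos by (intro prob_space_uniform_count_measure) auto

lemma space_digits: "space digits = ({..<n} \<times> UNIV) \<rightarrow>\<^sub>E {0..<int p}"
  by (simp add: digits_def space_PiM space_uniform_count_measure)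

lemma digit_sum_bounds:
  assumes "\<And>j. 0 \<le> f j \<and> f j < int p"
  shows "0 \<le> (\<Sum>j<k. f j * int p ^ j) \<and> (\<Sum>j<k. f j * int p ^ j) < int p ^ k"
proof (induction k)
  case (Suc k)
  have "f k * int p ^ k \<le> (int p - 1) * int p ^ k"
    using assms[of k] by (intro mult_right_mono) auto
  moreover have "0 \<le> f k * int p ^ k" using assms[of k] by simp
  ultimately show ?case using Suc by (simp add: algebra_simps)
qed simp

lemma expand_closed:
  assumes "w \<in> space digits"
  shows "expand w \<in> V"
proof -
  have "(\<lambda>k. \<Sum>j<k. w (i, j) * int p ^ j) \<in> padic_ints p" if "i < n" for i
  proof -
    have "0 \<le> w (i, j) \<and> w (i, j) < int p" for j
      using assms that by (auto simp: space_digits PiE_iff)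
    note b = digit_sum_bounds[of "\<lambda>j. w (i, j)", OF this]
    show ?thesis
      by (rule padic_intsI) (use b in auto)
  qed
  then show ?thesis by (auto simp: expand_def padic_vecs_def)
qed

lemma expand_eq_iff:
  assumes "w \<in> space digits" "a \<in> V" "i < n"
  shows "expand w i k = a i k \<longleftrightarrow> (\<forall>j<k. w (i, j) = (a i (Suc j) - a i j) div int p ^ j)"
proof (induction k)
  case 0
  show ?case using padic_intsD(1,2)[OF V_D[OF assms(2,3)], of 0] assms(3) by (simp add: expand_def)
next
  case (Suc k)
  note e = V_D[OF expand_closed[OF assms(1)] assms(3)] and a' = V_D[OF assms(2,3)]
  have pk: "int p ^ k > 0" using p_pos by simp
  have step: "expand w i (Suc k) = expand w i k + w (i, k) * int p ^ k"
    using assms(3) by (simp add: expand_def)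
  obtain q where q: "a i (Suc k) = a i k + q * int p ^ k"
    using padic_intsD(3)[OF a', of k] by (metis mod_mult_div_eq mult.commute)
  have "expand w i (Suc k) = a i (Suc k) \<longleftrightarrow> expand w i k = a i k \<and> w (i, k) = q"
  proof
    assume eq: "expand w i (Suc k) = a i (Suc k)"
    then have "expand w i k = a i k"
      using padic_intsD(3)[OF e, of k] padic_intsD(3)[OF a', of k] by simp
    then show "expand w i k = a i k \<and> w (i, k) = q" using eq step q pk by (metis add_left_cancel less_irrefl mult_right_cancel)
  qed (use step q in auto)
  also have "q = (a i (Suc k) - a i k) div int p ^ k" using q pk by simp
  finally show ?case using Suc by (auto simp: less_Suc_eq)
qed

lemma div_int_lt: "0 < (b::int) \<Longrightarrow> c < m * b \<Longrightarrow> c div b < m"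
proof -
  assume b: "0 < b" and c: "c < m * b"
  have "b * (c div b) \<le> c"
    using mult_div_mod_eq[of b c] pos_mod_sign[OF b, of c] by linarith
  with c have "b * (c div b) < b * m" by (simp add: mult.commute)
  then show ?thesis using b by (simp add: mult_less_cancel_left_pos)
qed

lemma digit_range:
  assumes "a \<in> V" "i < n"
  shows "(a i (Suc j) - a i j) div int p ^ j \<in> {0..<int p}"
proof -
  note a' = V_D[OF assms]
  have pk: "int p ^ j > 0" using p_pos by simp
  have "a i j \<le> a i (Suc j)"
    using padic_intsD(1,3)[OF a'] pk by (metis zmod_le_nonneg_dividend)
  moreover have "a i (Suc j) - a i j < int p * int p ^ j"
    using padic_intsD(1)[OF a', of j] padic_intsD(2)[OF a', of "Suc j"] by simp
  ultimately show ?thesis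
    using pk by (auto simp: pos_imp_zdiv_nonneg_iff intro!: div_int_lt)
qed

lemma expand_cyl:
  assumes "a \<in> V"
  shows "expand -` cyl k a \<inter> space digits =
    {w \<in> space digits. \<forall>z\<in>{..<n} \<times> {..<k}.
       w z \<in> {(a (fst z) (Suc (snd z)) - a (fst z) (snd z)) div int p ^ snd z}}"
  using expand_closed expand_eq_iff[OF _ assms] by (auto simp: cyl_def)

lemma expand_measurable: "expand \<in> measurable digits (padic_borel p n)"
proof (rule measurable_sigma_sets[OF sets_borel E_Pow])
  show "expand \<in> space digits \<rightarrow> V" using expand_closed by auto
  fix C assume "C \<in> E"
  then consider "C = {}" | k a where "a \<in> V" "C = cyl k a" by (auto simp: E_def cyls_def)
  then show "expand -` C \<inter> space digits \<in> sets digits"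
  proof cases
    case 2
    let ?c = "\<lambda>z. (a (fst z) (Suc (snd z)) - a (fst z) (snd z)) div int p ^ snd z"
    have "{w \<in> space digits. w z \<in> {?c z}} \<in> sets digits" if z: "z \<in> {..<n} \<times> {..<k}" for z
    proof -
      have m: "(\<lambda>w. w z) \<in> measurable digits (uniform_count_measure {0..<int p})"
        unfolding digits_def using z by (intro measurable_component_singleton) auto
      have "{?c z} \<in> sets (uniform_count_measure {0..<int p})"
        using digit_range[OF 2(1)] z by (auto simp: sets_uniform_count_measure)
      from measurable_sets[OF m this] show ?thesis
        by (simp add: vimage_def Int_def conj_commute)
    qed
    then show ?thesis
      unfolding 2(2) expand_cyl[OF 2(1)]
      by (intro sets.sets_Collect_finite_All) auto
  qed simp
qed

definition "haar = distr digits (padic_borel p n) expand"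

lemma haar_cyl_eq:
  assumes "a \<in> V"
  shows "emeasure haar (cyl k a) = (\<Prod>z\<in>{..<n} \<times> {..<k}. ennreal (1 / real p))"
proof -
  interpret product_prob_space "\<lambda>_. uniform_count_measure {0..<int p}" "{..<n} \<times> UNIV"
    using digits_prob by (intro product_prob_spaceI)
  have "emeasure haar (cyl k a) = emeasure digits (expand -` cyl k a \<inter> space digits)"
    unfolding haar_def by (rule emeasure_distr[OF expand_measurable cyl_sets[OF assms]])
  also have "\<dots> = (\<Prod>z\<in>{..<n} \<times> {..<k}. emeasure (uniform_count_measure {0..<int p})
      {(a (fst z) (Suc (snd z)) - a (fst z) (snd z)) div int p ^ snd z})"
    unfolding expand_cyl[OF assms] unfolding digits_def
    using digit_range[OF assms]
    by (intro emeasure_PiM_Collect) (auto simp: sets_uniform_count_measure)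
  also have "\<dots> = (\<Prod>z\<in>{..<n} \<times> {..<k}. ennreal (1 / real p))"
    using digit_range[OF assms]
    by (intro prod.cong refl, subst emeasure_uniform_count_measure) auto
  finally show ?thesis .
qed

lemma haar_normalized: "normalized_haar p n haar"
proof -
  have sets: "sets haar = sets (padic_borel p n)" by (simp add: haar_def)
  have one: "emeasure haar V = 1"
    using haar_cyl_eq[OF zerov, of 0] V_eq_cyl[OF zerov] by simp
  have "emeasure haar (vec_add p n a ` A) = emeasure haar A" if a: "a \<in> V" and A: "A \<in> sets haar" for a A
  proof -
    let ?t = "\<lambda>x. vec_diff p n x a"
    have t: "?t \<in> measurable haar (padic_borel p n)"
      using vec_diff_measurable[OF a] measurable_cong_sets[OF sets refl] by blast
    have sp: "space haar = V" by (simp add: haar_def space_borel)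
    have AV: "B \<subseteq> V" if "B \<in> sets haar" for B using sets.sets_into_space[OF that] sp by simp
    have dist: "emeasure (distr haar (padic_borel p n) ?t) B = emeasure haar (vec_add p n a ` B)"
      if "B \<in> sets haar" for B
      using that emeasure_distr[OF t, of B] sets vec_add_image[OF a AV[OF that]] sp by simp
    have "haar = distr haar (padic_borel p n) ?t"
    proof (rule measure_eqI_E)
      fix k b assume b: "b \<in> V"
      show "emeasure haar (cyl k b) = emeasure (distr haar (padic_borel p n) ?t) (cyl k b)"
        using dist[of "cyl k b"] cyl_sets[OF b] sets vec_add_cyl[OF a b]
          haar_cyl_eq[OF b] haar_cyl_eq[OF vec_add_closed[OF a b]] by simp
    qed (use sets one in auto)
    then show ?thesis using dist[OF A] by simp
  qed
  then show ?thesis using sets one by (simp add: normalized_haar_def)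
qed

lemma haar_ex1: "\<exists>!\<mu>. normalized_haar p n \<mu>"
  using haar_normalized haar_unique by blast

end

theorem normalized_haar_ex1:
  assumes "p \<ge> 2" "n \<ge> 1"
  shows "\<exists>!\<mu>. normalized_haar p n \<mu>"
  using padic_space.haar_ex1[OF padic_space.intro[OF assms]] .

corollary normalized_haar_padic_haar:
  assumes "p \<ge> 2" "n \<ge> 1"
  shows "normalized_haar p n (padic_haar p n)"
  unfolding padic_haar_def using normalized_haar_ex1[OF assms] by (rule theI')

end

(* A compatible map sends residue classes modulo p^k into residue classes. All residue classes
   modulo p^k have the same positive finite measure m. If F x and F y were congruent modulo p^k but
   x and y were not, the preimage of the class of F x would contain the disjoint classes of x and y,
   hence have measure at least 2 m instead of m. *)
theory Submission
  imports Defs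
begin

context padic_space
begin

text \<open>By \<open>dist_le_iff\<close>, \<open>cyl k x\<close> is the closed ball of radius 1/p^k
  around \<open>x\<close>, and a compatible map does not increase distances.\<close>

lemma compatible_image_cyl:
  assumes "compatible p n F" "F \<in> V \<rightarrow> V" "x \<in> V"
  shows "F ` cyl k x \<subseteq> cyl k (F x)"
proof
  fix z assume "z \<in> F ` cyl k x"
  then obtain y where y: "y \<in> V" "\<forall>i<n. y i k = x i k" "z = F y" by (auto simp: cyl_def)
  have "d (F y) (F x) \<le> d y x" using assms y by (simp add: compatible_def)
  also have "d y x \<le> 1 / real p ^ k" using dist_le_iff[OF y(1) assms(3)] y(2) by simp
  finally have "\<forall>i<n. F y i k = F x i k" using dist_le_iff assms y(1) by (simp add: Pi_iff)
  then show "z \<in> cyl k (F x)" using assms y by (auto simp: cyl_def)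
qed

text \<open>Both classes are translates of \<open>cyl k zerov\<close>, and the measure is
  translation invariant.\<close>

lemma haar_cyl_eq_haar_cyl:
  assumes "normalized_haar p n \<mu>" "a \<in> V" "b \<in> V"
  shows "emeasure \<mu> (cyl k a) = emeasure \<mu> (cyl k b)"
  using assms cyl_translate[of _ k] cyl_sets[OF zerov, of k]
  unfolding normalized_haar_def by metis

lemma haar_preserving_reflects_cong:
  assumes F: "F \<in> V \<rightarrow> V" "compatible p n F" "haar_preserving p n F"
    and x: "x \<in> V" and y: "y \<in> V"
    and cong: "\<forall>i<n. F x i k = F y i k"
  shows "\<forall>i<n. x i k = y i k"
proof (rule ccontr)
  assume neq: "\<not> (\<forall>i<n. x i k = y i k)"
  let ?\<mu> = "padic_haar p n"
  let ?m = "emeasure ?\<mu> (cyl k x)"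
  let ?P = "F -` cyl k (F x) \<inter> V"
  note haar = normalized_haar_padic_haar[OF p n]
  have sets: "sets ?\<mu> = sets (padic_borel p n)" using haar by (simp add: normalized_haar_def)
  have Fx: "F x \<in> V" "F y \<in> V" using F x y by auto
  have cx: "cyl k x \<in> sets ?\<mu>" "cyl k y \<in> sets ?\<mu>" "cyl k (F x) \<in> sets ?\<mu>"
    using cyl_sets x y Fx sets by auto
  \<comment> \<open>The two image classes coincide, so a single preimage \<open>?P\<close> contains
    both source classes.\<close>
  have "cyl k (F y) = cyl k (F x)" using cong by (auto simp: cyl_def)
  then have sub: "cyl k x \<union> cyl k y \<subseteq> ?P"
    using compatible_image_cyl[OF F(2,1) x, of k] compatible_image_cyl[OF F(2,1) y, of k]
      cyl_subset by blast
  have disj: "cyl k x \<inter> cyl k y = {}"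
    using neq by (auto simp: cyl_def)
  have "F \<in> measurable ?\<mu> ?\<mu>" using F(3) by (simp add: haar_preserving_def)
  from measurable_sets[OF this cx(3)] have P: "?P \<in> sets ?\<mu>"
    using space_borel sets_eq_imp_space_eq[OF sets] by simp
  have "?m + ?m = emeasure ?\<mu> (cyl k x \<union> cyl k y)"
    using plus_emeasure[OF cx(1,2) disj] haar_cyl_eq_haar_cyl[OF haar x y, of k] by simp
  also have "\<dots> \<le> emeasure ?\<mu> ?P" by (rule emeasure_mono[OF sub P])
  also have "\<dots> = emeasure ?\<mu> (cyl k (F x))"
    using F(3) cx(3) by (simp add: haar_preserving_def)
  also have "\<dots> = ?m" by (rule haar_cyl_eq_haar_cyl[OF haar Fx(1) x])
  finally have le: "?m + ?m \<le> ?m" .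
  \<comment> \<open>Cancelling \<open>?m\<close> in \<open>ennreal\<close> requires it to be finite;
    the total mass 1 bounds it.\<close>
  have "?m \<le> emeasure ?\<mu> V"
    using cyl_subset sets.top[of ?\<mu>] space_borel sets_eq_imp_space_eq[OF sets]
    by (intro emeasure_mono) auto
  then have "?m \<noteq> \<top>" using haar by (auto simp: normalized_haar_def top_unique)
  with le have "?m = 0"
    using ennreal_add_left_cancel_le[of ?m ?m 0] by simp
  \<comment> \<open>Finitely many classes, each of measure \<open>?m\<close>, add up to 1, so
    \<open>?m\<close> cannot vanish.\<close>
  then show False using haar_cyl[OF haar x, of k] by simp
qed

text \<open>The norm takes only the values 0 and 1/p^k, so distances can be compared through
  congruences modulo p^k alone.\<close>

lemma dist_leI:
  assumes "x \<in> V" "y \<in> V" "u \<in> V" "v \<in> V"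
    and "\<And>k. \<forall>i<n. u i k = v i k \<Longrightarrow> \<forall>i<n. x i k = y i k"
  shows "d x y \<le> d u v"
  using norm_cases[of "vec_diff p n u v"]
proof
  assume "d u v = 0"
  \<comment> \<open>Here \<open>u = v\<close>, so the last assumption applies at every level
    \<open>k\<close>.\<close>
  then have "x = y" using assms dist_eq_0_iff V_eqI by metis
  then show ?thesis using dist_eq_0_iff[OF assms(1,2)] dist_nonneg[of u v] by linarith
next
  assume "\<exists>k. d u v = 1 / real p ^ k"
  then obtain k where k: "d u v = 1 / real p ^ k" ..
  then have "\<forall>i<n. u i k = v i k" using dist_le_iff assms(3,4) by (metis order_refl)
  then show ?thesis unfolding k using dist_le_iff assms by blast
qed

end

theorem mainTheorem6:
  fixes p n :: nat
    and F :: "(nat \<Rightarrow> nat \<Rightarrow> int) \<Rightarrow> (nat \<Rightarrow> nat \<Rightarrow> int)"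
  assumes "prime p" and "n \<ge> 1"
    and "F \<in> padic_vecs p n \<rightarrow> padic_vecs p n"
    and "compatible p n F"
    and "haar_preserving p n F"
  shows "\<forall>x\<in>padic_vecs p n. \<forall>y\<in>padic_vecs p n.
           padic_norm p n (vec_diff p n (F x) (F y)) = padic_norm p n (vec_diff p n x y)"
proof (intro ballI)
  interpret padic_space p n
    using prime_ge_2_nat[OF assms(1)] assms(2) by unfold_locales
  fix x y assume xy: "x \<in> V" "y \<in> V"
  then have Fxy: "F x \<in> V" "F y \<in> V" using assms(3) by auto
  show "d (F x) (F y) = d x y"
  proof (rule antisym)
    show "d (F x) (F y) \<le> d x y" using assms(4) xy by (simp add: compatible_def)
    \<comment> \<open>Reflecting congruences at every level is the converse of compatibility, and
      \<open>dist_leI\<close> turns it into the reverse inequality.\<close>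
    show "d x y \<le> d (F x) (F y)"
      by (rule dist_leI[OF xy Fxy])
        (rule haar_preserving_reflects_cong[OF assms(3-5) xy])
  qed
qed

end
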